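(* Let $H_n$ be the $n$-dimensional twisted hypercube. If $\kappa(n-1)=1$, then $\kappa(H_{n}; P_2) =\kappa^{s}(H_{n}; P_2)= n-1$. If $\kappa(n-1)\geq 2$, then $\kappa(H_{n}; P_2) =\kappa^{s}(H_{n}; P_2)= n$.
   Context: **Twisted hypercube.** Define an integer function $\kappa$ (of one integer variable) by $\kappa(1)=0$ and $\kappa(n)=\max\{1,\lceil \log_2 n-2\log_2\log_2 n\rceil\}$ for $n\ge 2$. Let $Z_2^n$ be the set of binary strings $x=x_1x_2\cdots x_n$ of length $n$. For $x\in Z_2^n$ ($n\ge1$), $\phi(x)\in Z_2^n$ is the string with $\phi(x)_j=x_j+x_{n-\kappa(n)+j} \pmod 2$ for $1\le j\le \kappa(n)$ and $\phi(x)_j=x_j$ for $\kappa(n)<j\le n$ ($\phi$ is an involution on $Z_2^n$). The graph $H_1$ is $K_2$ with vertices $0,1$. For $n\ge 2$, $H_n$ has vertex set $Z_2^n$ and is obtained from two copies $0H_{n-1}$ and $1H_{n-1}$ of $H_{n-1}$ (vertices prefixed by $0$ and $1$ respectively) by adding the edges joining $0x$ and $1\phi(x)$ for all $x\in Z_2^{n-1}$. **Structure connectivity.** Let $G$ be a graph and $T$ a connected graph that is isomorphic to a subgraph of $G$. For a set $\mathcal F$ of subgraphs of $G$ (not required to be disjoint), $G-\mathcal F$ is the subgraph of $G$ induced by the vertices belonging to no member of $\mathcal F$. $\mathcal F$ is a $T$-structure-cut if every member is isomorphic to $T$ and $G-\mathcal F$ is disconnected; it is a $T$-substructure-cut if every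 member is isomorphic to a connected subgraph of $T$ and $G-\mathcal F$ is disconnected. $\kappa(G;T)$ (resp. $\kappa^s(G;T)$) is the minimum cardinality of a $T$-structure-cut (resp. $T$-substructure-cut) of $G$ (not to be confused with the one-variable integer function $\kappa$). $P_k$ is the path on $k$ vertices. *)

theory Defs
  imports
    Complex_Main
    "HOL-Library.Extended_Nat"
    "HOL-Library.Z2"
    "Graph_Theory.Graph_Theory"
begin

section \<open>Twisted hypercubes\<close>

text \<open>
  A binary string of length \<open>n\<close> is a \<^typ>\<open>bit list\<close>, addition on \<^typ>\<open>bit\<close> being addition
  modulo 2. List positions start at 0, so \<open>x ! j\<close> is the letter $x_{j+1}$.
\<close>

definition bitstrings :: "nat \<Rightarrow> bit list set" where
  "bitstrings n = {x. length x = n}"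

text \<open>The function is meant for \<open>n \<ge> 1\<close>; the value 0 at \<open>n = 0\<close> is a dummy.\<close>

definition kappa :: "nat \<Rightarrow> nat" where
  "kappa n = (if n \<le> 1 then 0
     else nat (max 1 \<lceil>log 2 (real n) - 2 * log 2 (log 2 (real n))\<rceil>))"

definition phi :: "bit list \<Rightarrow> bit list" where
  "phi x = (let n = length x; k = kappa n in
     map (\<lambda>j. if j < k then x ! j + x ! (n - k + j) else x ! j) [0..<n])"

text \<open>
  An undirected graph is a loop-free symmetric digraph without parallel arcs
  (\<^locale>\<open>pair_graph\<close>); an edge \<open>uv\<close> is the pair of arcs \<open>(u,v)\<close>, \<open>(v,u)\<close>.
  The graph for \<open>n = 0\<close> is a dummy.
\<close>

fun twisted_hypercube :: "nat \<Rightarrow> bit list pair_pre_digraph" where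
  "twisted_hypercube 0 = \<lparr> pverts = {[]}, parcs = {} \<rparr>"
| "twisted_hypercube (Suc 0) = \<lparr> pverts = {[0], [1]}, parcs = {([0], [1]), ([1], [0])} \<rparr>"
| "twisted_hypercube (Suc (Suc m)) =
    \<lparr> pverts = bitstrings (Suc (Suc m)),
      parcs = {(b # x, b # y) | b x y. (x, y) \<in> parcs (twisted_hypercube (Suc m))}
        \<union> {(0 # x, 1 # phi x) | x. x \<in> bitstrings (Suc m)}
        \<union> {(1 # phi x, 0 # x) | x. x \<in> bitstrings (Suc m)} \<rparr>"


section \<open>Structure connectivity\<close>

definition path_graph :: "nat \<Rightarrow> nat pair_pre_digraph" where
  "path_graph k = \<lparr> pverts = {0..<k},
     parcs = {(i, j). i < k \<and> j < k \<and> (j = Suc i \<or> i = Suc j)} \<rparr>"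

definition undirected_subgraph :: "'a pair_pre_digraph \<Rightarrow> 'a pair_pre_digraph \<Rightarrow> bool" where
  "undirected_subgraph S G \<longleftrightarrow> pair_graph S \<and> subgraph S G"

definition delete_family :: "'a pair_pre_digraph \<Rightarrow> 'a pair_pre_digraph set
    \<Rightarrow> ('a, 'a \<times> 'a) pre_digraph" where
  "delete_family G \<F> = with_proj G \<restriction> (pverts G - (\<Union>S\<in>\<F>. pverts S))"

text \<open>
  \<^const>\<open>Digraph_Component.connected\<close> is false for the graph without vertices; as usual, that
  graph is not called disconnected either.
\<close>

definition disconnected :: "('a, 'b) pre_digraph \<Rightarrow> bool" where
  "disconnected G \<longleftrightarrow> verts G \<noteq> {} \<and> \<not> Digraph_Component.connected G"

definition structure_cut ::
    "'a pair_pre_digraph \<Rightarrow> 'b pair_pre_digraph \<Rightarrow> 'a pair_pre_digraph set \<Rightarrow> bool" where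
  "structure_cut G T \<F> \<longleftrightarrow> finite \<F>
     \<and> (\<forall>S\<in>\<F>. undirected_subgraph S G \<and> digraph_iso S T)
     \<and> disconnected (delete_family G \<F>)"

definition substructure_cut ::
    "'a pair_pre_digraph \<Rightarrow> 'b pair_pre_digraph \<Rightarrow> 'a pair_pre_digraph set \<Rightarrow> bool" where
  "substructure_cut G T \<F> \<longleftrightarrow> finite \<F>
     \<and> (\<forall>S\<in>\<F>. undirected_subgraph S G
          \<and> (\<exists>T'. undirected_subgraph T' T \<and> Digraph_Component.connected T' \<and> digraph_iso S T'))
     \<and> disconnected (delete_family G \<F>)"

text \<open>The minimum cardinality of a cut; it is \<open>\<infinity>\<close> when there is no cut.\<close>

definition structure_connectivity :: "'a pair_pre_digraph \<Rightarrow> 'b pair_pre_digraph \<Rightarrow> enat" where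
  "structure_connectivity G T = (INF \<F> \<in> {\<F>. structure_cut G T \<F>}. enat (card \<F>))"

definition substructure_connectivity :: "'a pair_pre_digraph \<Rightarrow> 'b pair_pre_digraph \<Rightarrow> enat" where
  "substructure_connectivity G T = (INF \<F> \<in> {\<F>. substructure_cut G T \<F>}. enat (card \<F>))"

end

theory Submission
  imports Defs "HOL-Analysis.Convex"
begin

text \<open>
  The vertices of a cut form a vertex separator between two sets \<open>A\<close> and \<open>B\<close>. Splitting along the
  perfect matching between the two copies of \<open>H\<^bsub>n-1\<^esub>\<close> shows inductively that a separator has at
  least \<open>n\<close> vertices, at least \<open>2n - 2\<close> if \<open>A\<close> and \<open>B\<close> have at least two elements each, and
  at least \<open>2n - 1\<close> if \<open>n \<ge> 5\<close> and they have at least three elements each. Hence a cut with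
  fewer than \<open>n\<close> members isolates a vertex or an edge. Since \<open>H\<^bsub>n\<^esub>\<close> is triangle-free, no member
  covers two neighbours of the same vertex: this rules out a vertex, and an edge \<open>uv\<close> can only be
  isolated by \<open>n - 1\<close> edges each joining a neighbour of \<open>u\<close> to a neighbour of \<open>v\<close>. Then \<open>uv\<close>
  lies at one of the two lowest levels, that is, \<open>u\<close> and \<open>v\<close> differ just in the last or just in the
  second last letter, and the twist at the top level destroys the required 4-cycle as soon as
  \<open>\<kappa>(n - 1) \<ge> 2\<close>. If \<open>\<kappa>(n - 1) = 1\<close>, flipping the second last letter is an automorphism of
  \<open>H\<^bsub>n\<^esub>\<close> that moves every vertex to a neighbour, which yields a cut with \<open>n - 1\<close> edges.
\<close>

section \<open>The function kappa\<close>

lemma bit_add_self [simp]: "(a::bit) + a = 0" "(a::bit) + (a + b) = b"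
  by (cases a; cases b; simp)+

lemma kappa_0_1 [simp]: "kappa 0 = 0" "kappa (Suc 0) = 0"
  by (simp_all add: kappa_def)

lemma kappa_ge_1: "n \<ge> 2 \<Longrightarrow> 1 \<le> kappa n"
  by (simp add: kappa_def)

lemma kappa_le_1_iff:
  assumes "n \<ge> 2"
  shows "kappa n \<le> 1 \<longleftrightarrow> log 2 n - 2 * log 2 (log 2 n) \<le> 1"
proof -
  have "kappa n \<le> 1 \<longleftrightarrow> \<lceil>log 2 n - 2 * log 2 (log 2 n)\<rceil> \<le> 1"
    using assms by (simp add: kappa_def nat_le_iff del: ceiling_le_iff ceiling_le_one)
  also have "\<dots> \<longleftrightarrow> log 2 n - 2 * log 2 (log 2 n) \<le> 1"
    by (simp add: ceiling_le_iff)
  finally show ?thesis .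
qed

lemma log2_ge_1: "n \<ge> 2 \<Longrightarrow> 1 \<le> log 2 (real n)"
  using log_le_cancel_iff[of 2 2 n] by simp

text \<open>The flip in \<open>adj_flip_second_last\<close> must commute with the twist at every
  level, so the bound has to pass down. The expression \<open>log 2 n - 2 * log 2 (log 2 n)\<close>
  is not monotone: it first decreases.\<close>

lemma kappa_le_1_downward:
  assumes "kappa n \<le> 1" "m \<le> n"
  shows "kappa m \<le> 1"
proof (cases "m \<ge> 2")
  case True
  let ?L = "log 2 n" and ?M = "log 2 m"
  have M: "1 \<le> ?M" and le: "?M \<le> ?L"
    using True assms(2) log2_ge_1 by auto
  have L: "?L - 2 * log 2 ?L \<le> 1"
    using assms True kappa_le_1_iff[of n] by simp
  \<comment> \<open>The function \<open>s - 2 log s\<close> is convex and at most 1 at \<open>1\<close> and at \<open>?L\<close>, hence also in between.\<close>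
  define t where "t = (?M - 1) / (?L - 1)"
  have t: "0 \<le> t" "t \<le> 1"
    using M le by (auto simp: t_def divide_le_eq)
  have t_eq: "?M = (1 - t) * 1 + t * ?L"
  \<comment> \<open>For \<open>?L = 1\<close> division by zero makes \<open>t = 0\<close>, and
    \<open>?M = 1\<close> as well.\<close>
  proof (cases "?L = 1")
    case False
    then have "t * (?L - 1) = ?M - 1" by (simp add: t_def)
    then show ?thesis by (simp add: algebra_simps)
  qed (use M le in \<open>simp add: t_def\<close>)
  have "(1 - t) * log 2 1 + t * log 2 ?L \<le> log 2 ((1 - t) * 1 + t * ?L)"
    using concave_onD[OF log_concave[of 2], of t 1 ?L] t M le by simp
  then have "t * log 2 ?L \<le> log 2 ?M"
    using t_eq by simp
  moreover have "t * (?L - 2 * log 2 ?L) \<le> t"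
    using L t by (simp add: mult_left_le)
  then have "t * ?L - 2 * (t * log 2 ?L) \<le> t"
    by (simp add: algebra_simps)
  moreover have "?M = 1 - t + t * ?L"
    using t_eq by simp
  ultimately have "?M - 2 * log 2 ?M \<le> 1"
    by linarith
  then show ?thesis
    using True kappa_le_1_iff by blast
next
  case False
  then have "m = 0 \<or> m = 1" by linarith
  then show ?thesis by auto
qed

text \<open>\<open>kappa n \<ge> 2\<close> forces \<open>log 2 n \<ge> 2\<close>; then the
  subtracted term is at least 2, and rounding up gives back less than 1.\<close>

lemma two_power_kappa_less:
  assumes "kappa n \<ge> 2"
  shows "2 ^ (kappa n + 1) < n"
proof -
  have n: "n \<ge> 2"
  proof (rule ccontr)
    assume "\<not> n \<ge> 2"
    then have "n = 0 \<or> n = 1" by linarith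
    then show False using assms by auto
  qed
  let ?L = "log 2 n"
  have L: "1 \<le> ?L" using n log2_ge_1 by blast
  have gt: "?L - 2 * log 2 ?L > 1"
    using kappa_le_1_iff[OF n] assms by linarith
  have "?L \<ge> 2"
  proof (rule ccontr)
    assume "\<not> ?L \<ge> 2"
    define t where "t = ?L - 1"
    have t: "0 \<le> t" "t \<le> 1" using L \<open>\<not> ?L \<ge> 2\<close> by (auto simp: t_def)
    \<comment> \<open>On \<open>[1, 2]\<close> the logarithm lies above its chord, so
      \<open>?L - 2 * log 2 ?L \<le> 1 - t\<close>.\<close>
    have "t \<le> log 2 ((1 - t) * 1 + t * 2)"
      using concave_onD[OF log_concave[of 2], of t 1 2] t by simp
    then have "t \<le> log 2 ?L" by (simp add: t_def algebra_simps)
    with gt t show False by (simp add: t_def)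
  qed
  then have "1 \<le> log 2 ?L"
    using log_le_cancel_iff[of 2 2 ?L] by simp
  have "kappa n = nat \<lceil>?L - 2 * log 2 ?L\<rceil>"
    using n gt by (simp add: kappa_def max_def less_ceiling_iff)
  then have "real (kappa n) < ?L - 2 * log 2 ?L + 1"
    using gt by (simp add: of_nat_ceiling) linarith
  then have "real (kappa n + 1) < ?L"
    using \<open>1 \<le> log 2 ?L\<close> by simp
  then have "2 powr real (kappa n + 1) < n"
    using n by (simp add: less_log_iff)
  then show ?thesis
    by (metis of_nat_less_iff of_nat_numeral of_nat_power powr_realpow zero_less_numeral)
qed

lemma kappa_cases: "n \<ge> 2 \<Longrightarrow> kappa n = 1 \<or> kappa n \<ge> 2 \<and> 2 * kappa n + 3 \<le> n"
proof -
  assume n: "n \<ge> 2"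
  have *: "2 * k + 2 \<le> 2 ^ (k + 1)" for k :: nat
    by (induction k) auto
  show ?thesis
    using kappa_ge_1[OF n] two_power_kappa_less[of n] *[of "kappa n"] by linarith
qed

text \<open>The last \<open>kappa n\<close> letters, which \<open>phi\<close> reads, are thus
  disjoint from the first \<open>kappa n\<close>, which it changes. This makes \<open>phi\<close> an
  involution.\<close>

lemma kappa_half: "2 * kappa n \<le> n"
  using kappa_cases[of n] by (cases "n \<ge> 2") (auto simp: not_le less_2_cases_iff)

lemma kappa_less: "n \<ge> 1 \<Longrightarrow> kappa n < n"
  using kappa_half[of n] by linarith

section \<open>Adjacency in the twisted hypercube\<close>

lemma length_phi [simp]: "length (phi x) = length x"
  by (simp add: phi_def Let_def)

lemma phi_nth:
  "j < length x \<Longrightarrow> phi x ! j =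
    (if j < kappa (length x) then x ! j + x ! (length x - kappa (length x) + j) else x ! j)"
  by (simp add: phi_def Let_def)

lemma phi_Nil [simp]: "phi [] = []"
  by (simp add: phi_def)

lemma phi_singleton [simp]: "phi [a] = [a]"
  by (simp add: phi_def)

lemma phi_phi [simp]: "phi (phi x) = x"
proof (rule nth_equalityI)
  let ?n = "length x" and ?k = "kappa (length x)"
  fix j assume "j < length (phi (phi x))"
  then have j: "j < ?n" by simp
  show "phi (phi x) ! j = x ! j"
  proof (cases "j < ?k")
    case True
    have k: "?n - ?k + j < ?n" "\<not> ?n - ?k + j < ?k"
      using True kappa_half[of ?n] by linarith+
    have "phi (phi x) ! j = phi x ! j + phi x ! (?n - ?k + j)"
      using True j phi_nth[of j "phi x"] by (simp only: length_phi if_True)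
    also have "\<dots> = (x ! j + x ! (?n - ?k + j)) + x ! (?n - ?k + j)"
      by (simp only: phi_nth[OF j] phi_nth[OF k(1)] True k(2) if_True if_False)
    finally show ?thesis by (simp only: bit_add_self add.assoc add_0_right)
  qed (use j in \<open>simp add: phi_nth\<close>)
qed simp

lemma phi_eq_iff [simp]: "phi x = phi y \<longleftrightarrow> x = y"
  by (metis phi_phi)

text \<open>Adjacency in all dimensions at once. As \<open>phi\<close> is an involution,
  \<open>y = phi x\<close> covers both orientations of a matching edge; \<open>phi [] = []\<close>
  gives the edge of \<open>K_2\<close>.\<close>

fun adj :: "bit list \<Rightarrow> bit list \<Rightarrow> bool" where
  "adj (a # x) (b # y) = (if a = b then adj x y else y = phi x)"
| "adj _ _ = False"

lemma adj_length: "adj x y \<Longrightarrow> length y = length x"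
  by (induction x y rule: adj.induct) (auto split: if_splits)

lemma adj_sym: "adj x y \<Longrightarrow> adj y x"
  by (induction x y rule: adj.induct) (auto split: if_splits)

lemma adj_commute: "adj x y \<longleftrightarrow> adj y x"
  using adj_sym by blast

lemma adj_irrefl [simp]: "\<not> adj x x"
  by (induction x) auto

lemma bitstrings_iff [simp]: "x \<in> bitstrings n \<longleftrightarrow> length x = n"
  by (simp add: bitstrings_def)

lemma bitstrings_0: "bitstrings 0 = {[]}"
  by (auto simp: bitstrings_def)

lemma UNIV_bit: "UNIV = {0, 1 :: bit}"
  using bit_not_zero_iff by blast

lemma finite_bitstrings [simp]: "finite (bitstrings n)"
  and card_bitstrings: "card (bitstrings n) = 2 ^ n"
proof -
  have bit: "finite (UNIV :: bit set)" "card (UNIV :: bit set) = 2"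
    by (simp_all add: UNIV_bit)
  show "finite (bitstrings n)" "card (bitstrings n) = 2 ^ n"
    using finite_lists_length_eq[OF bit(1), of n] card_lists_length_eq[OF bit(1), of n]
    by (simp_all add: bitstrings_def bit(2))
qed

lemma pverts_twisted_hypercube: "pverts (twisted_hypercube n) = bitstrings n"
proof (induction n rule: twisted_hypercube.induct)
  case 2
  show ?case using UNIV_bit by (auto simp: bitstrings_def length_Suc_conv)
qed (auto simp: bitstrings_0)

lemma parcs_twisted_hypercube:
  "(x, y) \<in> parcs (twisted_hypercube n) \<longleftrightarrow> length x = n \<and> adj x y"
proof (induction n arbitrary: x y rule: twisted_hypercube.induct)
  case 1
  show ?case by auto
next
  case 2
  show ?case
    by (cases x; cases y) (auto simp: length_Suc_conv)
next
  case (3 m)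
  show ?case
  proof (cases x)
    case (Cons a x')
    show ?thesis
    proof (cases y)
      case Cons': (Cons b y')
      have "(x, y) \<in> parcs (twisted_hypercube (Suc (Suc m))) \<longleftrightarrow>
          a = b \<and> (x', y') \<in> parcs (twisted_hypercube (Suc m))
        \<or> a = 0 \<and> b = 1 \<and> y' = phi x' \<and> length x' = Suc m
        \<or> a = 1 \<and> b = 0 \<and> x' = phi y' \<and> length y' = Suc m"
        unfolding Cons Cons' twisted_hypercube.simps(3) by (auto simp del: twisted_hypercube.simps)
      also have "\<dots> \<longleftrightarrow> length x' = Suc m \<and> (if a = b then adj x' y' else y' = phi x')"
        unfolding 3 by (cases a; cases b) auto
      finally show ?thesis
        by (simp add: Cons Cons')
    qed (auto simp: Cons)
  qed auto
qed

lemma neighbours_Cons: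
  "{y. adj (a # x) y} = Cons a ` {y. adj x y} \<union> {(a + 1) # phi x}"
proof -
  have "b = a + 1 \<longleftrightarrow> b \<noteq> a" for b
    by (cases a; cases b) auto
  then have "adj (a # x) y \<longleftrightarrow> y \<in> Cons a ` {y. adj x y} \<union> {(a + 1) # phi x}" for y
    by (cases y) (auto split: if_splits)
  then show ?thesis by blast
qed

lemma finite_neighbours [simp]: "finite {y. adj x y}"
  by (induction x) (simp_all add: neighbours_Cons)

lemma card_neighbours: "card {y. adj x y} = length x"
proof (induction x)
  case (Cons a x)
  have "a \<noteq> a + 1" by (cases a) auto
  then have "card {y. adj (a # x) y} = card (Cons a ` {y. adj x y}) + 1"
    by (subst neighbours_Cons, subst card_Un_disjoint) auto
  also have "card (Cons a ` {y. adj x y}) = length x"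
    using Cons by (simp add: card_image)
  finally show ?case by simp
qed simp

text \<open>Two of three heads agree. If the third differs, its vertex has only one neighbour in the
  other copy; otherwise induction applies.\<close>

lemma adj_triangle_free: "adj x y \<Longrightarrow> adj y z \<Longrightarrow> \<not> adj x z"
proof (induction x y arbitrary: z rule: adj.induct)
  case (1 a x b y)
  from 1(3) obtain c z' where z: "z = c # z'"
    by (cases z) auto
  have "a = b \<or> b = c \<or> a = c"
    by (cases a; cases b; cases c) simp_all
  then consider "a = b" "b = c" | "a = b" "b \<noteq> c" | "a \<noteq> b" "b = c" | "a \<noteq> b" "b \<noteq> c" "a = c"
    by blast
  then show ?case
  proof cases
    case 1
    then show ?thesis using "1.IH" "1.prems" z by simp
  next
    case 2
    then show ?thesis using "1.prems" z by (metis adj.simps(1) adj_irrefl phi_eq_iff)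
  next
    case 3
    then show ?thesis using "1.prems" z by (metis adj.simps(1) adj_irrefl)
  next
    case 4
    then show ?thesis using "1.prems" z by (metis adj.simps(1) adj_irrefl phi_phi)
  qed
qed simp_all

section \<open>Vertex separators\<close>

text \<open>The sides need not be connected, so restricting both to a copy of the smaller hypercube
  gives such a pair again unless one side becomes empty.\<close>

definition separates :: "nat \<Rightarrow> bit list set \<Rightarrow> bit list set \<Rightarrow> bool" where
  "separates n A B \<longleftrightarrow> A \<subseteq> bitstrings n \<and> B \<subseteq> bitstrings n \<and> A \<noteq> {} \<and> B \<noteq> {} \<and> A \<inter> B = {}
     \<and> (\<forall>x\<in>A. \<forall>y\<in>B. \<not> adj x y)"

definition separator :: "nat \<Rightarrow> bit list set \<Rightarrow> bit list set \<Rightarrow> bit list set" where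
  "separator n A B = bitstrings n - A - B"

definition half :: "bit \<Rightarrow> bit list set \<Rightarrow> bit list set" where
  "half a A = {x. a # x \<in> A}"

lemma separates_sym: "separates n A B \<Longrightarrow> separates n B A"
  unfolding separates_def using adj_sym by blast

lemma separator_commute: "separator n A B = separator n B A"
  by (auto simp: separator_def)

lemma finite_separator [simp]: "finite (separator n A B)"
  by (simp add: separator_def)

lemma half_subset: "A \<subseteq> bitstrings (Suc n) \<Longrightarrow> half a A \<subseteq> bitstrings n"
  by (auto simp: half_def)

lemma half_separator: "half a (separator (Suc n) A B) = separator n (half a A) (half a B)"
  by (auto simp: half_def separator_def)

lemma card_half:
  assumes "A \<subseteq> bitstrings (Suc n)"
  shows "card A = card (half a A) + card (half (a + 1) A)"
proof -
  have fin: "finite (half b A)" for b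
    using half_subset[OF assms] finite_bitstrings finite_subset by blast
  have a: "a \<noteq> a + 1" "b = a \<or> b = a + 1" for b
    by (cases a; simp) (cases a; cases b; simp)
  have "A = Cons a ` half a A \<union> Cons (a + 1) ` half (a + 1) A"
  proof
    show "A \<subseteq> Cons a ` half a A \<union> Cons (a + 1) ` half (a + 1) A"
    proof
      fix x assume x: "x \<in> A"
      then obtain b y where "x = b # y"
        using assms by (cases x) auto
      then show "x \<in> Cons a ` half a A \<union> Cons (a + 1) ` half (a + 1) A"
        using x a(2)[of b] by (auto simp: half_def)
    qed
  qed (auto simp: half_def)
  moreover have "card (Cons a ` half a A \<union> Cons (a + 1) ` half (a + 1) A) =
      card (Cons a ` half a A) + card (Cons (a + 1) ` half (a + 1) A)"
    using a(1) by (intro card_Un_disjoint) (auto simp: fin)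
  ultimately have "card A = card (Cons a ` half a A) + card (Cons (a + 1) ` half (a + 1) A)"
    by (rule trans[OF arg_cong[where f = card]])
  then show ?thesis
    by (simp add: card_image)
qed

lemma card_separator_half:
  "card (separator (Suc n) A B) =
    card (separator n (half a A) (half a B)) + card (separator n (half (a + 1) A) (half (a + 1) B))"
  unfolding half_separator[symmetric] by (rule card_half) (auto simp: separator_def)

lemma card_separator:
  assumes "A \<subseteq> bitstrings n" "B \<subseteq> bitstrings n" "A \<inter> B = {}"
  shows "card A + card B + card (separator n A B) = 2 ^ n"
proof -
  have fin: "finite A" "finite B"
    using assms finite_subset finite_bitstrings by blast+
  have "card (bitstrings n) = card (A \<union> B) + card (separator n A B)"
    using assms fin
    by (subst card_Un_disjoint[symmetric]) (auto simp: separator_def intro!: arg_cong[where f = card])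
  also have "card (A \<union> B) = card A + card B"
    using assms fin by (simp add: card_Un_disjoint)
  finally show ?thesis by (simp add: card_bitstrings)
qed

text \<open>A vertex of \<open>A\<close> in copy \<open>a\<close> is matched to a vertex outside
  \<open>B\<close>, hence in \<open>A\<close> or in the separator; the matching is
  injective.\<close>

lemma card_le_opposite_half:
  assumes "separates (Suc n) A B"
  shows "card (half a A) \<le> card (half (a + 1) A) + card (separator n (half (a + 1) A) (half (a + 1) B))"
proof -
  have sub: "A \<subseteq> bitstrings (Suc n)"
    using assms by (simp add: separates_def)
  have "phi ` half a A \<subseteq> half (a + 1) A \<union> separator n (half (a + 1) A) (half (a + 1) B)"
  proof
    fix y assume "y \<in> phi ` half a A"
    then obtain x where x: "a # x \<in> A" "y = phi x"
      by (auto simp: half_def)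
    then have "length x = n" using sub by auto
    moreover have "adj (a # x) ((a + 1) # y)"
      using x by (cases a) auto
    then have "(a + 1) # y \<notin> B"
      using assms x(1) unfolding separates_def by blast
    ultimately show "y \<in> half (a + 1) A \<union> separator n (half (a + 1) A) (half (a + 1) B)"
      using x by (auto simp: half_def separator_def)
  qed
  moreover have "finite (half (a + 1) A)"
    using half_subset[OF sub] finite_bitstrings finite_subset by blast
  ultimately have "card (phi ` half a A) \<le> card (half (a + 1) A \<union> separator n (half (a + 1) A) (half (a + 1) B))"
    by (intro card_mono) auto
  also have "\<dots> \<le> card (half (a + 1) A) + card (separator n (half (a + 1) A) (half (a + 1) B))"
    by (rule card_Un_le)
  finally show ?thesis
    by (simp add: card_image inj_on_def)
qed

lemma separates_half:
  assumes "separates (Suc n) A B" "half a A \<noteq> {}" "half a B \<noteq> {}"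
  shows "separates n (half a A) (half a B)"
proof -
  have "\<not> adj x y" if "x \<in> half a A" "y \<in> half a B" for x y
  proof -
    have "\<not> adj (a # x) (a # y)"
      using that assms(1) unfolding half_def separates_def by blast
    then show ?thesis by simp
  qed
  moreover have "half a A \<inter> half a B = {}"
    using assms(1) by (auto simp: separates_def half_def)
  ultimately show ?thesis
    using assms half_subset unfolding separates_def by blast
qed

text \<open>The partners of \<open>B\<close> in copy \<open>a\<close> all lie in the separator. If
  \<open>A\<close> misses the other copy, that copy consists of \<open>B\<close> and separator
  vertices, which yields \<open>2 ^ n\<close> separator vertices in total.\<close>

lemma separates_one_sided:
  assumes sep: "separates (Suc n) A B" and B: "half a B = {}"
  shows "2 ^ n \<le> card (separator (Suc n) A B)
    \<or> separates n (half (a + 1) A) (half (a + 1) B) \<and> card (half (a + 1) B) = card B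
      \<and> card B \<le> card (separator n (half a A) (half a B))"
proof -
  have sub: "A \<subseteq> bitstrings (Suc n)" "B \<subseteq> bitstrings (Suc n)" "B \<noteq> {}"
    using sep by (auto simp: separates_def)
  have disj: "half b A \<inter> half b B = {}" for b
    using sep by (auto simp: separates_def half_def)
  have cB: "card (half (a + 1) B) = card B"
    using card_half[OF sub(2), of a] B by simp
  have a: "a + 1 + 1 = a" by (cases a) auto
  have le: "card B \<le> card (separator n (half a A) (half a B))"
    using card_le_opposite_half[OF separates_sym[OF sep], of "a + 1"] B cB a
    by (simp add: separator_commute)
  show ?thesis
  proof (cases "half (a + 1) A = {}")
    case True
    then have "card B + card (separator n (half (a + 1) A) (half (a + 1) B)) = 2 ^ n"
      using card_separator[OF half_subset[OF sub(1)] half_subset[OF sub(2)] disj, of "a + 1"] cB by simp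
    then show ?thesis
      using le card_separator_half[of n A B a] by simp
  next
    case False
    have "half (a + 1) B \<noteq> {}"
      using cB sub finite_subset[OF sub(2) finite_bitstrings] by auto
    then show ?thesis
      using separates_half[OF sep False] cB le by blast
  qed
qed

text \<open>The case distinction behind all separator bounds. In case \<open>one\<close>, the side
  \<open>D\<close> lies inside copy \<open>a\<close>, and its partners are \<open>card D\<close>
  further separator vertices in the other copy.\<close>

lemma separates_cases:
  assumes "separates (Suc n) A B"
  obtains (both) "\<And>a. separates n (half a A) (half a B)"
  | (large) "2 ^ n \<le> card (separator (Suc n) A B)"
  | (one) a C D where "(C, D) = (A, B) \<or> (C, D) = (B, A)" "separates n (half a C) (half a D)"
      "card (half a D) = card D"
      "card D + card (separator n (half a C) (half a D)) \<le> card (separator (Suc n) C D)"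
proof -
  have a: "a + 1 + 1 = a" for a :: bit by (cases a) auto
  show ?thesis
  proof (cases "\<exists>a. half a A = {} \<or> half a B = {}")
    case False
    then show ?thesis using both separates_half[OF assms] by blast
  next
    case True
    then obtain a where "half a A = {} \<or> half a B = {}" ..
    then obtain C D where CD: "(C, D) = (A, B) \<or> (C, D) = (B, A)" "half a D = {}"
      by blast
    then have "separates (Suc n) C D"
      using assms separates_sym by blast
    then have "2 ^ n \<le> card (separator (Suc n) C D)
      \<or> separates n (half (a + 1) C) (half (a + 1) D) \<and> card (half (a + 1) D) = card D
      \<and> card D \<le> card (separator n (half a C) (half a D))"
      using CD(2) by (rule separates_one_sided)
    then show ?thesis
    proof
      assume "2 ^ n \<le> card (separator (Suc n) C D)"
      then show ?thesis
        using CD(1) large separator_commute by auto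
    next
      assume "separates n (half (a + 1) C) (half (a + 1) D) \<and> card (half (a + 1) D) = card D
        \<and> card D \<le> card (separator n (half a C) (half a D))"
      then show ?thesis
        using CD(1) one[of C D "a + 1"] card_separator_half[of n C D a] by simp
    qed
  qed
qed

section \<open>Lower bounds for separators\<close>

lemma separates_card:
  assumes "separates n A B"
  shows "card A \<ge> 1" "card B \<ge> 1" "card A + card B + card (separator n A B) = 2 ^ n"
proof -
  have "finite A" "finite B"
    using assms finite_subset[OF _ finite_bitstrings] unfolding separates_def by blast+
  then show "card A \<ge> 1" "card B \<ge> 1"
    using assms by (auto simp: separates_def Suc_le_eq card_gt_0_iff)
  show "card A + card B + card (separator n A B) = 2 ^ n"
    using assms card_separator by (simp add: separates_def)
qed

lemma not_separates_0: "\<not> separates 0 A B"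
  using separates_card[of 0 A B] by auto

lemma Suc_le_two_power: "Suc n \<le> 2 ^ n"
  by (induction n) auto

lemma separator_ge: "separates n A B \<Longrightarrow> n \<le> card (separator n A B)"
proof (induction n arbitrary: A B)
  case (Suc n)
  from Suc.prems show ?case
  proof (cases rule: separates_cases)
    case both
    then have "n > 0"
      using not_separates_0 by (metis gr0I)
    then show ?thesis
      using Suc.IH[OF both[of 0]] Suc.IH[OF both[of 1]] card_separator_half[of n A B 0] by simp
  next
    case large
    then show ?thesis using Suc_le_two_power[of n] by linarith
  next
    case (one a C D)
    have "card (separator (Suc n) A B) = card (separator (Suc n) C D)"
      using one(1) separator_commute by auto
    then show ?thesis
      using one Suc.IH[OF one(2)] separates_card(2)[OF one(2)] by linarith
  qed
qed simp

lemma separator_ge_2: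
  "separates n A B \<Longrightarrow> card A \<ge> 2 \<Longrightarrow> card B \<ge> 2 \<Longrightarrow> 2 * n \<le> card (separator n A B) + 2"
proof (induction n arbitrary: A B)
  case (Suc n)
  have pow: "2 * n \<le> 2 ^ n" "n \<ge> 3 \<Longrightarrow> 2 * n + 1 \<le> 2 ^ n"
    using Suc_le_two_power[of "n - 1"] Suc_le_two_power[of "n - 2"]
    by (cases n; cases "n - 1"; simp; fail)+
  from Suc.prems(1) have "2 * n + 2 \<le> card (separator (Suc n) A B) + 2"
  proof (cases rule: separates_cases)
    case both
    show ?thesis
      using separator_ge[OF both[of 0]] separator_ge[OF both[of 1]] card_separator_half[of n A B 0]
      by simp
  next
    case large
    then show ?thesis using pow by linarith
  next
    case (one a C D)
    have eq: "card (separator (Suc n) A B) = card (separator (Suc n) C D)"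
      using one(1) separator_commute by auto
    have D: "card D \<ge> 2"
      using one(1) Suc.prems by auto
    show ?thesis
    proof (cases "card (half a C) \<ge> 2")
      case True
      then show ?thesis
        using Suc.IH[OF one(2) True] one(3,4) D eq by linarith
    next
      case False
      \<comment> \<open>Copy \<open>a\<close> has one vertex of \<open>C\<close> besides
        \<open>D\<close> and the separator, so the whole separator has at least
        \<open>2 ^ n - 1\<close> vertices. For \<open>n < 3\<close> the bound \<open>n + 2\<close>
        is used instead.\<close>
      then have "card (half a C) = 1"
        using separates_card(1)[OF one(2)] by linarith
      then have "2 ^ n \<le> card (separator (Suc n) A B) + 1"
        using separates_card(3)[OF one(2)] one(3,4) eq by linarith
      moreover have "n + 2 \<le> card (separator (Suc n) A B)"
        using separator_ge[OF one(2)] one(4) D eq by linarith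
      ultimately show ?thesis
        using pow by (cases "n \<ge> 3") linarith+
    qed
  qed
  then show ?case by simp
qed simp

text \<open>
  The bound fails for \<open>n = 4\<close>: the middle layer of the ordinary 4-cube has only 6 vertices and
  separates two stars with 5 vertices each.
\<close>

lemma separator_ge_3:
  assumes "separates n A B" "card A \<ge> 3" "card B \<ge> 3" "n \<ge> 5"
  shows "2 * n \<le> card (separator n A B) + 1"
proof -
  from assms obtain m where m: "n = Suc m" "m \<ge> 4"
    by (cases n) auto
  have pow: "2 * m + 3 \<le> 2 ^ m"
    using m(2) by (induction m rule: dec_induct) auto
  note sep = assms(1)[unfolded m(1)]
  from sep have "2 * m + 2 \<le> card (separator (Suc m) A B) + 1"
  proof (cases rule: separates_cases)
    case both
    let ?s = "\<lambda>a. card (separator m (half a A) (half a B))"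
    have ge: "m \<le> ?s a" for a
      using separator_ge[OF both] .
    have half: "card (half a A) \<ge> 1" "card (half a B) \<ge> 1"
      "card (half a A) + card (half a B) + ?s a = 2 ^ m" for a
      using separates_card[OF both] by auto
    have s: "card (separator (Suc m) A B) = ?s a + ?s (a + 1)" for a
      by (rule card_separator_half)
    have sub: "A \<subseteq> bitstrings (Suc m)" "B \<subseteq> bitstrings (Suc m)"
      using sep by (auto simp: separates_def)
    show ?thesis
    proof (cases "\<exists>a. card (half a A) \<ge> 2 \<and> card (half a B) \<ge> 2")
      case True
      then obtain a where a: "card (half a A) \<ge> 2" "card (half a B) \<ge> 2" by blast
      show ?thesis
        using separator_ge_2[OF both a] ge[of "a + 1"] s[of a] m(2) by linarith
    next
      case False
      \<comment> \<open>\<open>A\<close> is concentrated in one copy and \<open>B\<close> in the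
        other, each with a single vertex elsewhere. By the matching,
        \<open>card (half a A) \<le> 1 + ?s (a + 1)\<close>, so the separator has at least
        \<open>2 ^ m - 2\<close> vertices.\<close>
      have "card (half 0 A) \<ge> 2 \<or> card (half (0 + 1) A) \<ge> 2"
        using card_half[OF sub(1), of 0] assms(2) by linarith
      then obtain a where a: "card (half a A) \<ge> 2" by blast
      then have "\<not> card (half a B) \<ge> 2"
        using False by blast
      then have B: "card (half a B) = 1"
        using half(2)[of a] by linarith
      then have "card (half (a + 1) B) \<ge> 2"
        using card_half[OF sub(2), of a] assms(3) by linarith
      then have "\<not> card (half (a + 1) A) \<ge> 2"
        using False by blast
      then have "card (half (a + 1) A) = 1"
        using half(1)[of "a + 1"] by linarith
      then have "card (half a A) \<le> 1 + ?s (a + 1)"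
        using card_le_opposite_half[OF sep, of a] by simp
      then show ?thesis
        using half(3)[of a] B s[of a] pow by linarith
    qed
  next
    case large
    then show ?thesis using pow by linarith
  next
    case (one a C D)
    have eq: "card (separator (Suc m) A B) = card (separator (Suc m) C D)"
      using one(1) separator_commute by auto
    have D: "card D \<ge> 3"
      using one(1) assms by auto
    show ?thesis
    proof (cases "card (half a C) \<ge> 2")
      case True
      \<comment> \<open>No induction is involved: \<open>separator_ge_2\<close> in copy
        \<open>a\<close> plus at least three partners of \<open>D\<close>.\<close>
      then show ?thesis
        using separator_ge_2[OF one(2) True] one(3,4) D eq by linarith
    next
      case False
      then have "card (half a C) = 1"
        using separates_card(1)[OF one(2)] by linarith
      then show ?thesis
        using separates_card(3)[OF one(2)] one(3,4) eq pow by linarith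
    qed
  qed
  then show ?thesis using m(1) by simp
qed

section \<open>Covering neighbourhoods by edges\<close>

text \<open>Covers the vertex sets of all copies of connected subgraphs of \<open>P_2\<close>; the
  lower bounds refer to members of a cut only through these sets.\<close>

definition clique :: "bit list set \<Rightarrow> bool" where
  "clique S \<longleftrightarrow> finite S \<and> card S \<le> 2 \<and> (\<forall>x\<in>S. \<forall>y\<in>S. x \<noteq> y \<longrightarrow> adj x y)"

text \<open>A clique contains at most one vertex of the independent set \<open>X\<close>, so
  choosing a clique around each vertex is injective, and bijective in the case of equality.\<close>

lemma card_le_cliques:
  assumes "finite \<S>" "\<And>S. S \<in> \<S> \<Longrightarrow> clique S" "X \<subseteq> \<Union>\<S>"
    and indep: "\<And>y z. y \<in> X \<Longrightarrow> z \<in> X \<Longrightarrow> \<not> adj y z"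
  shows "card X \<le> card \<S>" "card X = card \<S> \<Longrightarrow> S \<in> \<S> \<Longrightarrow> S \<inter> X \<noteq> {}"
proof -
  have "\<forall>y\<in>X. \<exists>S\<in>\<S>. y \<in> S"
    using assms(3) by blast
  then obtain f where f: "\<And>y. y \<in> X \<Longrightarrow> f y \<in> \<S> \<and> y \<in> f y"
    by metis
  have inj: "inj_on f X"
  proof (rule inj_onI)
    fix y z assume yz: "y \<in> X" "z \<in> X" "f y = f z"
    show "y = z"
      using f[OF yz(1)] f[OF yz(2)] yz(3) indep[OF yz(1,2)] assms(2)[of "f y"]
      unfolding clique_def by metis
  qed
  have im: "f ` X \<subseteq> \<S>"
    using f by blast
  show "card X \<le> card \<S>"
    using card_inj_on_le[OF inj im assms(1)] .
  assume "card X = card \<S>" "S \<in> \<S>"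
  then have "f ` X = \<S>"
    using card_subset_eq[OF assms(1) im] card_image[OF inj] by simp
  then obtain y where "y \<in> X" "S = f y"
    using \<open>S \<in> \<S>\<close> by blast
  then show "S \<inter> X \<noteq> {}"
    using f by blast
qed

text \<open>
  Every edge at \<open>u\<close> other than \<open>uv\<close> spans a 4-cycle with \<open>uv\<close>; only around such an edge can the
  \<open>2n - 2\<close> neighbours of its ends be covered by \<open>n - 1\<close> edges.
\<close>

definition square_edge :: "bit list \<Rightarrow> bit list \<Rightarrow> bool" where
  "square_edge u v \<longleftrightarrow> (\<forall>u'. adj u u' \<and> u' \<noteq> v \<longrightarrow> (\<exists>v'. adj v v' \<and> v' \<noteq> u \<and> adj u' v'))"

lemma square_edgeD:
  "square_edge u v \<Longrightarrow> adj u u' \<Longrightarrow> u' \<noteq> v \<Longrightarrow> \<exists>v'. adj v v' \<and> v' \<noteq> u \<and> adj u' v'"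
  by (auto simp: square_edge_def)

lemma vertex_cover_ge:
  assumes "finite \<S>" "\<And>S. S \<in> \<S> \<Longrightarrow> clique S" "{y. adj u y} \<subseteq> \<Union>\<S>"
  shows "length u \<le> card \<S>"
proof -
  have "\<not> adj y z" if "y \<in> {y. adj u y}" "z \<in> {y. adj u y}" for y z
    using that adj_triangle_free by blast
  then show ?thesis
    using card_le_cliques(1)[OF assms] by (simp add: card_neighbours)
qed

text \<open>The neighbours of \<open>v\<close> other than \<open>u\<close> are independent and no
  fewer than the cliques, so every clique contains one. The one in the clique covering
  \<open>u'\<close> is the required \<open>v'\<close>; it differs from \<open>u'\<close> as there
  are no triangles.\<close>

lemma edge_cover_square:
  assumes "finite \<S>" "\<And>S. S \<in> \<S> \<Longrightarrow> clique S" "adj u v"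
    and cover: "{y. adj u y} \<union> {y. adj v y} - {u, v} \<subseteq> \<Union>\<S>"
    and card: "card \<S> < length v"
  shows "square_edge u v"
  unfolding square_edge_def
proof (intro allI impI)
  fix u' assume u': "adj u u' \<and> u' \<noteq> v"
  let ?X = "{y. adj v y} - {u}"
  have "card ?X = length v - 1"
    using assms(3) adj_sym by (simp add: card_neighbours)
  have X: "?X \<subseteq> \<Union>\<S>"
    using cover by auto
  have indep: "\<not> adj y z" if "y \<in> ?X" "z \<in> ?X" for y z
    using that adj_triangle_free by blast
  have "card ?X = card \<S>"
    using card_le_cliques(1)[OF assms(1,2) X indep] card \<open>card ?X = length v - 1\<close> by simp
  moreover have "u' \<noteq> u"
    using u' adj_irrefl by blast
  then have "u' \<in> {y. adj u y} \<union> {y. adj v y} - {u, v}"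
    using u' by simp
  then obtain S where S: "S \<in> \<S>" "u' \<in> S"
    using cover by blast
  ultimately obtain v' where v': "v' \<in> S" "v' \<in> ?X"
    using card_le_cliques(2)[OF assms(1,2) X indep, of S] by blast
  then have "u' \<noteq> v'"
    using u' assms(3) adj_triangle_free by blast
  then have "adj u' v'"
    using S v' assms(2) by (auto simp: clique_def)
  then show "\<exists>v'. adj v v' \<and> v' \<noteq> u \<and> adj u' v'"
    using v' by auto
qed

text \<open>A 4-cycle with \<open>u'\<close> in the same copy cannot leave it, as \<open>v'\<close>
  would be matched to two vertices. If \<open>u'\<close> is the partner of \<open>a # x\<close>,
  then \<open>v'\<close> must be the partner of \<open>a # y\<close>.\<close>

lemma square_edge_Cons_same:
  assumes "square_edge (a # x) (a # y)" "adj x y"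
  shows "square_edge x y" "adj (phi x) (phi y)"
proof -
  show "square_edge x y"
    unfolding square_edge_def
  proof (intro allI impI)
    fix x' assume x': "adj x x' \<and> x' \<noteq> y"
    then obtain v' where v': "adj (a # y) v'" "v' \<noteq> a # x" "adj (a # x') v'"
      using square_edgeD[OF assms(1), of "a # x'"] by auto
    then obtain c z where z: "v' = c # z" by (cases v') auto
    then have "c = a"
      using v' x' by (cases "a = c") auto
    then show "\<exists>y'. adj y y' \<and> y' \<noteq> x \<and> adj x' y'"
      using v' z by auto
  qed
  obtain v' where v': "adj (a # y) v'" "v' \<noteq> a # x" "adj ((a + 1) # phi x) v'"
    using square_edgeD[OF assms(1), of "(a + 1) # phi x"] by (cases a) auto
  then obtain c z where z: "v' = c # z" by (cases v') auto
  then have "c \<noteq> a"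
    using v' by (cases "c = a") (auto split: if_splits)
  then have "c = a + 1"
    by (cases a; cases c) simp_all
  moreover have "z = phi y"
    using v'(1) z \<open>c \<noteq> a\<close> by simp
  ultimately show "adj (phi x) (phi y)"
    using v' z by simp
qed

text \<open>Around a matching edge the fourth vertex is forced to be the partner of
  \<open>a # x'\<close>.\<close>

lemma square_edge_Cons_diff:
  assumes "square_edge (a # x) (b # phi x)" "a \<noteq> b" "adj x x'"
  shows "adj (phi x) (phi x')"
proof -
  obtain v' where v': "adj (b # phi x) v'" "v' \<noteq> a # x" "adj (a # x') v'"
    using square_edgeD[OF assms(1), of "a # x'"] assms by auto
  then obtain c z where z: "v' = c # z" by (cases v') auto
  have "c = b"
  proof (rule ccontr)
    assume "c \<noteq> b"
    then have "c = a" using assms(2) by (cases a; cases b; cases c) auto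
    then show False using v' z \<open>c \<noteq> b\<close> by auto
  qed
  then show ?thesis
    using v' z assms(2) by auto
qed

section \<open>Flipping one of the last two letters\<close>

definition flip :: "nat \<Rightarrow> bit list \<Rightarrow> bit list" where
  "flip i x = x[i := x ! i + 1]"

lemma length_flip [simp]: "length (flip i x) = length x"
  by (simp add: flip_def)

lemma flip_nth: "j < length x \<Longrightarrow> flip i x ! j = (if j = i then x ! j + 1 else x ! j)"
  by (auto simp: flip_def nth_list_update)

lemma flip_Cons [simp]: "flip 0 (a # x) = (a + 1) # x" "flip (Suc i) (a # x) = a # flip i x"
  by (simp_all add: flip_def)

lemma bit_neq_Suc [simp]: "(a::bit) \<noteq> a + 1" "a + 1 \<noteq> (a::bit)"
  by (cases a; simp)+

lemma flip_flip [simp]: "i < length x \<Longrightarrow> flip i (flip i x) = x"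
  by (rule nth_equalityI) (auto simp: flip_nth)

text \<open>Counting by \<open>d\<close> from the end makes the position stable under prefixing.
  Once the letter is the head, the rest has length at most 1 and \<open>phi\<close> fixes
  it.\<close>

lemma adj_flip:
  assumes "d = 1 \<or> d = 2" "d \<le> length x"
  shows "adj x (flip (length x - d) x)"
  using assms(2)
proof (induction x)
  case (Cons a x)
  show ?case
  proof (cases "d \<le> length x")
    case True
    then show ?thesis using Cons by (simp add: Suc_diff_le)
  next
    case False
    then have l: "Suc (length x) = d"
      using Cons.prems by simp
    then have "phi x = x"
      using assms(1) by (cases x) auto
    then show ?thesis
      using l by simp
  qed
qed (use assms in auto)

text \<open>
  An edge created at level \<open>l + 1\<close> changes only the first \<open>kappa l\<close> letters of the suffix of length \<open>l\<close>.
\<close>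

lemma adj_differ_near_end:
  assumes d: "d = 1 \<or> d = 2"
    and "adj p q" "d \<le> length p" "p ! (length p - d) \<noteq> q ! (length p - d)" "j + 2 * d \<le> length p"
  shows "p ! j = q ! j"
  using assms(2-)
proof (induction p q arbitrary: j rule: adj.induct)
  case (1 a x b y)
  \<comment> \<open>For \<open>d = 2\<close> this excludes suffixes of length 2, where
    \<open>kappa 2 = 1\<close> and the twist can change the second last letter.\<close>
  have l: "d \<le> length x" "2 * d \<le> Suc (length x)"
    using 1(5) d by auto
  then have idx: "length (a # x) - d = Suc (length x - d)"
    by (simp add: Suc_diff_le)
  show ?case
  proof (cases "a = b")
    case True
    show ?thesis
    proof (cases j)
      case (Suc i)
      have "adj x y"
        using 1(2) True by simp
      moreover have "x ! (length x - d) \<noteq> y ! (length x - d)"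
        using 1(4) unfolding idx nth_Cons_Suc .
      moreover have "i + 2 * d \<le> length x"
        using 1(5) Suc by simp
      ultimately have "x ! i = y ! i"
        using 1(1) True l(1) by blast
      then show ?thesis
        by (simp add: Suc)
    qed (simp add: True)
  next
    case False
    have "kappa (length x) \<le> length x - d"
    proof (cases "length x = 3")
      case True
      then show ?thesis using kappa_half[of 3] d by auto
    next
      case False
      then show ?thesis
        using kappa_half[of "length x"] d l by auto
    qed
    moreover have "length x - d < length x"
      using d l by auto
    ultimately have "phi x ! (length x - d) = x ! (length x - d)"
      by (simp add: phi_nth)
    moreover have "y = phi x"
      using False 1(2) by simp
    ultimately show ?thesis
      using 1(4) unfolding idx nth_Cons_Suc by simp
  qed
qed simp_all

text \<open>Letter \<open>length x - d\<close> is kept by \<open>phi\<close> and added to letter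
  \<open>kappa (length x) - d\<close>. So the images differ at both positions, which
  \<open>adj_differ_near_end\<close> forbids for adjacent words.\<close>

lemma not_adj_phi_flip:
  assumes d: "d = 1 \<or> d = 2"
    and k: "d \<le> kappa (length x)" "kappa (length x) + d \<le> length x"
  shows "\<not> adj (phi x) (phi (flip (length x - d) x))"
proof
  let ?n = "length x" and ?k = "kappa (length x)"
  let ?q = "phi (flip (?n - d) x)"
  assume adj: "adj (phi x) ?q"
  have "phi x ! (?n - d) = x ! (?n - d)" "?q ! (?n - d) = x ! (?n - d) + 1"
    using d k by (auto simp: phi_nth flip_nth)
  then have "phi x ! (length (phi x) - d) \<noteq> ?q ! (length (phi x) - d)"
    by simp
  then have eq: "phi x ! (?k - d) = ?q ! (?k - d)"
    using adj_differ_near_end[OF d adj] k by simp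
  have i: "?n - ?k + (?k - d) = ?n - d" "?k - d < ?n" "?k - d < ?k" "?k - d \<noteq> ?n - d" "?n - d < ?n"
    using d k by auto
  have "phi x ! (?k - d) = x ! (?k - d) + x ! (?n - d)"
    using i by (simp only: phi_nth if_True)
  moreover have "?q ! (?k - d) = x ! (?k - d) + (x ! (?n - d) + 1)"
    using i by (simp only: phi_nth flip_nth length_flip if_True if_False simp_thms)
  moreover have "a + b \<noteq> a + (b + 1)" for a b :: bit
    by (cases a; cases b) simp_all
  ultimately show False
    using eq by metis
qed

text \<open>
  Edges of the levels above the second are excluded by the neighbour of \<open>x\<close> that differs from it
  in the last letter.
\<close>

lemma square_edge_flip:
  "adj u v \<Longrightarrow> square_edge u v \<Longrightarrow>
    \<exists>d. (d = 1 \<or> d = 2) \<and> d \<le> length u \<and> v = flip (length u - d) u"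
proof (induction u v rule: adj.induct)
  case (1 a x b y)
  show ?case
  proof (cases "a = b")
    case True
    then have xy: "adj x y" "square_edge x y"
      using 1 square_edge_Cons_same by auto
    then obtain d where "d = 1 \<or> d = 2" "d \<le> length x" "y = flip (length x - d) x"
      using 1 True by blast
    then show ?thesis
      using True by (intro exI[of _ d]) (auto simp: Suc_diff_le)
  next
    case False
    then have y: "y = phi x"
      using 1(2) by simp
    have b: "b = a + 1"
      using False by (cases a; cases b) simp_all
    have "length x < 2"
    proof (rule ccontr)
      assume "\<not> length x < 2"
      then have "adj x (flip (length x - 1) x)" "1 \<le> kappa (length x)"
          "kappa (length x) + 1 \<le> length x"
        using adj_flip[of 1 x] kappa_ge_1[of "length x"] kappa_less[of "length x"] by auto
      then show False
        using not_adj_phi_flip[of 1 x] square_edge_Cons_diff[OF _ False] 1(3) y by blast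
    qed
    then have "x = [] \<or> (\<exists>c. x = [c])"
      by (cases x) auto
    then show ?thesis
    proof
      assume "x = []"
      then show ?thesis using y b by (intro exI[of _ 1]) simp
    next
      assume "\<exists>c. x = [c]"
      then show ?thesis using y b by (intro exI[of _ 2]) auto
    qed
  qed
qed simp_all

text \<open>The twist at the top level reads both of the last two letters, so
  \<open>not_adj_phi_flip\<close> applies for either \<open>d\<close>.\<close>

lemma kappa_ge_2_not_square_edge:
  assumes "kappa (length u - 1) \<ge> 2" "adj u v"
  shows "\<not> square_edge u v"
proof
  assume sq: "square_edge u v"
  obtain d where d: "d = 1 \<or> d = 2" "v = flip (length u - d) u"
    using square_edge_flip[OF assms(2) sq] by blast
  obtain a x where u: "u = a # x"
    using assms(2) by (cases u) auto
  have k: "2 \<le> kappa (length x)" "kappa (length x) + 2 \<le> length x"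
    using assms(1) kappa_half[of "length x"] by (auto simp: u)
  then have "length u - d = Suc (length x - d)"
    using d(1) by (auto simp: u)
  then have v: "v = a # flip (length x - d) x"
    using d(2) by (simp add: u)
  have "adj x (flip (length x - d) x)"
    using adj_flip[of d x] d k by auto
  then show False
    using square_edge_Cons_same(2)[of a x] sq not_adj_phi_flip[of d x] d k unfolding u v by auto
qed

text \<open>With \<open>kappa = 1\<close> only the last letter is read by \<open>phi\<close>, so the
  flip does not disturb the twist.\<close>

lemma phi_flip_second_last:
  assumes "kappa (length x) = 1"
  shows "phi (flip (length x - 2) x) = flip (length x - 2) (phi x)"
proof (rule nth_equalityI)
  let ?n = "length x"
  have n: "?n \<ge> 2"
    using assms kappa_half[of ?n] by simp
  fix j assume "j < length (phi (flip (?n - 2) x))"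
  then have j: "j < ?n" by simp
  have last: "?n - 1 + 0 < ?n" "?n - 1 + 0 \<noteq> ?n - 2"
    using n by auto
  show "phi (flip (?n - 2) x) ! j = flip (?n - 2) (phi x) ! j"
  proof (cases "j = 0")
    case True
    \<comment> \<open>In words of length 2 the flipped letter is the twisted one; the two additions
      commute.\<close>
    then show ?thesis
      using j last
      by (cases "0 = ?n - 2") (simp_all only: phi_nth flip_nth length_flip length_phi assms if_True if_False simp_thms zero_less_one add.assoc add.commute add.left_commute)
  next
    case False
    then show ?thesis
      using j by (simp add: phi_nth flip_nth assms)
  qed
qed simp

lemma adj_flip_second_last:
  assumes "\<And>l. l < length x \<Longrightarrow> kappa l \<le> 1" "adj x y"
  shows "adj (flip (length x - 2) x) (flip (length y - 2) y)"
  using assms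
proof (induction x y rule: adj.induct)
  case (1 a x b y)
  have len: "length y = length x"
    using adj_length[OF 1(3)] by simp
  show ?case
  proof (cases "length x \<ge> 2")
    \<comment> \<open>The flipped position is the head here, also for length 1, where truncated
      subtraction gives 0.\<close>
    case False
    then have "length x = 0 \<or> length x = 1"
      by linarith
    then have phi: "phi x = x"
      by (auto simp: length_Suc_conv)
    have "a + 1 = b + 1 \<longleftrightarrow> a = b"
      by (cases a; cases b) auto
    then show ?thesis
      using 1(3) phi False len by (auto simp: numeral_2_eq_2 split: if_splits)
  next
    case True
    then have idx: "length (a # x) - 2 = Suc (length x - 2)" "length (b # y) - 2 = Suc (length y - 2)"
      using len by auto
    have "kappa (length x) = 1"
      using 1(2)[of "length x"] kappa_ge_1[OF True] by simp
    then have "phi (flip (length x - 2) x) = flip (length x - 2) (phi x)"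
      by (rule phi_flip_second_last)
    then show ?thesis
      using 1 len unfolding idx by (auto split: if_splits)
  qed
qed simp_all

section \<open>Structure cuts by paths on two vertices\<close>

text \<open>Take as \<open>A\<close> all vertices reachable from some \<open>u\<close>; conversely,
  no walk leaves \<open>A\<close>. This reduces disconnection to vertex sets.\<close>

lemma disconnected_delete_family_iff:
  "disconnected (delete_family (twisted_hypercube n) \<F>) \<longleftrightarrow>
    (\<exists>A B. separates n A B \<and> A \<union> B = bitstrings n - (\<Union>S\<in>\<F>. pverts S))"
proof -
  define W where "W = bitstrings n - (\<Union>S\<in>\<F>. pverts S)"
  let ?G = "delete_family (twisted_hypercube n) \<F>"
  define R where "R = symcl (arcs_ends ?G)"
  have verts: "verts ?G = W"
    by (simp add: delete_family_def pverts_twisted_hypercube W_def)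
  have "(x, y) \<in> arcs_ends ?G \<longleftrightarrow> x \<in> W \<and> y \<in> W \<and> adj x y" for x y
    by (auto simp: delete_family_def arcs_ends_conv pverts_twisted_hypercube parcs_twisted_hypercube W_def)
  then have R: "(x, y) \<in> R \<longleftrightarrow> x \<in> W \<and> y \<in> W \<and> adj x y" for x y
    unfolding symcl_def R_def using adj_commute by fastforce
  have W: "W \<subseteq> bitstrings n"
    by (auto simp: W_def)
  have dis: "disconnected ?G \<longleftrightarrow> (\<exists>u\<in>W. \<exists>v\<in>W. (u, v) \<notin> rtrancl_on W R)"
    unfolding disconnected_def connected_conv verts R_def by blast
  show ?thesis
    unfolding W_def[symmetric]
  proof
    assume "disconnected ?G"
    then obtain u v where uv: "u \<in> W" "v \<in> W" "(u, v) \<notin> rtrancl_on W R"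
      using dis by blast
    let ?A = "{w. (u, w) \<in> rtrancl_on W R}"
    have sub: "?A \<subseteq> W"
      by (auto dest: in_rtrancl_on_in_F(2))
    have "u \<in> ?A"
      using uv(1) by simp
    moreover have "\<not> adj x y" if "x \<in> ?A" "y \<in> W - ?A" for x y
    proof
      assume "adj x y"
      then have "(x, y) \<in> R"
        using that sub R by blast
      then have "(u, y) \<in> rtrancl_on W R"
        using that by (auto intro: rtrancl_on_into_rtrancl_on)
      then show False using that by blast
    qed
    moreover have "v \<in> W - ?A"
      using uv by blast
    ultimately have "separates n ?A (W - ?A)"
      unfolding separates_def using sub W by blast
    moreover have "?A \<union> (W - ?A) = W"
      using sub by blast
    ultimately show "\<exists>A B. separates n A B \<and> A \<union> B = W"
      by blast
  next
    assume "\<exists>A B. separates n A B \<and> A \<union> B = W"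
    then obtain A B where AB: "separates n A B" "A \<union> B = W" by blast
    then obtain u v where uv: "u \<in> A" "v \<in> B"
      by (auto simp: separates_def)
    have "w \<in> A" if "(u, w) \<in> rtrancl_on W R" for w
      using that
    proof (induction rule: rtrancl_on_induct)
      case (step y z)
      then have "adj y z" "z \<in> A \<union> B"
        using R AB(2) by blast+
      then show ?case
        using step AB(1) unfolding separates_def by blast
    qed (rule uv)
    moreover have "v \<notin> A"
      using uv AB(1) by (auto simp: separates_def)
    ultimately have "(u, v) \<notin> rtrancl_on W R"
      by blast
    moreover have "u \<in> W" "v \<in> W"
      using uv AB(2) by blast+
    ultimately show "disconnected ?G"
      unfolding dis by (intro bexI)
  qed
qed

lemma pverts_path_graph_2: "pverts (path_graph 2) = {0, 1}"
  by (auto simp: path_graph_def)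

lemma parcs_path_graph_2: "parcs (path_graph 2) = {(0, 1), (1, 0)}"
  by (auto simp: path_graph_def less_2_cases_iff)

lemma pair_graph_path_graph_2: "pair_graph (path_graph 2)"
  by unfold_locales (auto simp: pverts_path_graph_2 parcs_path_graph_2 symmetric_def sym_def)

lemma connected_arc:
  assumes "Digraph_Component.connected (with_proj T)" "x \<in> pverts T" "y \<in> pverts T" "x \<noteq> y"
  shows "parcs T \<noteq> {}"
proof
  assume empty: "parcs T = {}"
  have "(x, y) \<in> rtrancl_on (pverts T) (symcl (parcs T))"
    using assms unfolding connected_conv by simp
  then have "y = x"
    by (induction rule: rtrancl_on_induct) (auto simp: empty symcl_def)
  then show False using assms by simp
qed

text \<open>If \<open>S\<close> has two vertices, connectedness yields an arc of \<open>T\<close>,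
  whose preimage can only join these two.\<close>

lemma clique_of_substructure:
  assumes S: "undirected_subgraph S (twisted_hypercube n)"
    and T: "undirected_subgraph T (path_graph 2)" "Digraph_Component.connected (with_proj T)"
    and iso: "digraph_iso (with_proj S) (with_proj T)"
  shows "clique (pverts S)"
proof -
  interpret S: pair_graph S
    using S by (simp add: undirected_subgraph_def)
  obtain f :: "(bit list, bit list \<times> bit list, nat, nat \<times> nat) digraph_isomorphism"
    where f: "inj_on (iso_verts f) (pverts S)"
      "pverts T = iso_verts f ` pverts S" "parcs T = iso_arcs f ` parcs S"
  proof -
    obtain f where "pre_digraph.digraph_isomorphism (with_proj S) f" "with_proj T = app_iso f (with_proj S)"
      using iso by (auto simp: digraph_iso_def)
    then show ?thesis
      using that[of f] by (metis app_iso_simps(1,2) pre_digraph.digraph_isomorphism_inj_on_verts with_proj_simps(1,2))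
  qed
  have subT: "pverts T \<subseteq> {0, 1}"
    using T(1) by (simp add: undirected_subgraph_def subgraph_def pverts_path_graph_2)
  have cardT: "card (pverts T) = card (pverts S)"
    using f card_image by simp
  have card: "card (pverts S) \<le> 2"
    using card_mono[OF _ subT] cardT by simp
  have "adj x y" if xy: "x \<in> pverts S" "y \<in> pverts S" "x \<noteq> y" for x y
  proof -
    have "parcs T \<noteq> {}"
      using connected_arc[OF T(2), of "iso_verts f x" "iso_verts f y"] f xy by (auto dest: inj_onD)
    then obtain a b where ab: "(a, b) \<in> parcs S"
      using f(3) by auto
    have pS: "pverts S = {x, y}"
      using xy card S.pair_finite_verts by (intro card_seteq[symmetric]) auto
    have "a \<in> {x, y}" "b \<in> {x, y}" "a \<noteq> b"
      using S.in_arcsD1[OF ab] S.in_arcsD2[OF ab] S.pair_no_loops[OF ab] pS by auto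
    moreover have "adj a b"
      using S ab parcs_twisted_hypercube[of a b n] by (auto simp: undirected_subgraph_def subgraph_def)
    ultimately show "adj x y"
      using adj_sym by auto
  qed
  then show ?thesis
    using card S.pair_finite_verts by (auto simp: clique_def)
qed

lemma substructure_cutE:
  assumes "substructure_cut (twisted_hypercube n) (path_graph 2) \<F>"
  obtains \<S> A B where "finite \<S>" "card \<S> \<le> card \<F>" "\<And>S. S \<in> \<S> \<Longrightarrow> clique S"
    "separates n A B" "separator n A B \<subseteq> \<Union>\<S>"
proof -
  have "finite \<F>" "\<And>S. S \<in> pverts ` \<F> \<Longrightarrow> clique S"
    using assms clique_of_substructure by (auto simp: substructure_cut_def)
  moreover obtain A B where AB: "separates n A B" "A \<union> B = bitstrings n - (\<Union>S\<in>\<F>. pverts S)"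
    using assms disconnected_delete_family_iff by (auto simp: substructure_cut_def)
  moreover have "separator n A B \<subseteq> \<Union>(pverts ` \<F>)"
    using AB(2) by (auto simp: separator_def)
  ultimately show ?thesis
    using that[of "pverts ` \<F>" A B] card_image_le[of \<F> pverts] by blast
qed

section \<open>Lower bounds for substructure cuts\<close>

lemma card_Union_cliques:
  assumes "finite \<S>" "\<And>S. S \<in> \<S> \<Longrightarrow> clique S" "X \<subseteq> \<Union>\<S>"
  shows "card X \<le> 2 * card \<S>"
proof -
  have "finite (\<Union>\<S>)"
    using assms(1,2) by (auto simp: clique_def)
  then have "card X \<le> card (\<Union>\<S>)"
    using assms(3) by (rule card_mono)
  also have "\<dots> \<le> (\<Sum>S\<in>\<S>. card S)"
    by (rule card_Union_le_sum_card)
  also have "\<dots> \<le> (\<Sum>S\<in>\<S>. 2)"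
    using assms(2) by (intro sum_mono) (auto simp: clique_def)
  finally show ?thesis by simp
qed

lemma separates_neighbour:
  assumes "separates n A B" "separator n A B \<subseteq> U" "x \<in> A" "adj x y"
  shows "y \<in> A \<union> U"
proof -
  have "length y = n"
    using assms adj_length by (auto simp: separates_def)
  moreover have "y \<notin> B"
    using assms by (auto simp: separates_def)
  ultimately show ?thesis
    using assms(2) by (auto simp: separator_def)
qed

lemma singleton_side_card:
  assumes "finite \<S>" "\<And>S. S \<in> \<S> \<Longrightarrow> clique S"
    and sep: "separates n A B" "separator n A B \<subseteq> \<Union>\<S>" "card A = 1"
  shows "n \<le> card \<S>"
proof -
  obtain u where A: "A = {u}"
    using sep(3) by (auto simp: card_1_singleton_iff)
  then have "length u = n"
    using sep(1) by (auto simp: separates_def)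
  moreover have "y \<in> \<Union>\<S>" if "adj u y" for y
    using separates_neighbour[OF sep(1,2) _ that] that A by auto
  ultimately show ?thesis
    using vertex_cover_ge[OF assms(1,2), of u] by blast
qed

text \<open>If \<open>u\<close> and \<open>v\<close> are not adjacent, all neighbours of
  \<open>u\<close> must be covered, as for a single vertex. If they are, too few cliques would make
  \<open>uv\<close> a square edge.\<close>

lemma doubleton_side_card:
  assumes "finite \<S>" "\<And>S. S \<in> \<S> \<Longrightarrow> clique S"
    and sep: "separates n A B" "separator n A B \<subseteq> \<Union>\<S>" "card A = 2"
    and "kappa (n - 1) \<ge> 2"
  shows "n \<le> card \<S>"
proof (rule ccontr)
  assume less: "\<not> n \<le> card \<S>"
  obtain u v where A: "A = {u, v}" "u \<noteq> v"
    using sep(3) by (auto simp: card_2_iff)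
  then have len: "length u = n" "length v = n"
    using sep(1) by (auto simp: separates_def)
  have nb: "y \<in> {u, v} \<union> \<Union>\<S>" if "adj u y \<or> adj v y" for y
    using separates_neighbour[OF sep(1,2), of _ y] that unfolding A(1) by blast
  show False
  proof (cases "adj u v")
    case True
    have "{y. adj u y} \<union> {y. adj v y} - {u, v} \<subseteq> \<Union>\<S>"
      using nb by blast
    then have "square_edge u v"
      using edge_cover_square[OF assms(1,2) True] less len by simp
    then show False
      using kappa_ge_2_not_square_edge True assms(6) len by blast
  next
    case False
    have "{y. adj u y} \<subseteq> \<Union>\<S>"
    proof
      fix y assume "y \<in> {y. adj u y}"
      then have "adj u y" by simp
      moreover then have "y \<noteq> u" "y \<noteq> v"
        using False adj_irrefl by blast+
      ultimately show "y \<in> \<Union>\<S>"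
        using nb[of y] by blast
    qed
    then show False
      using vertex_cover_ge[OF assms(1,2), of u] less len by simp
  qed
qed

lemma substructure_cut_card_ge_n_minus_1:
  assumes "substructure_cut (twisted_hypercube n) (path_graph 2) \<F>"
  shows "n \<le> card \<F> + 1"
proof -
  obtain \<S> A B where \<S>: "finite \<S>" "card \<S> \<le> card \<F>" "\<And>S. S \<in> \<S> \<Longrightarrow> clique S"
    and sep: "separates n A B" "separator n A B \<subseteq> \<Union>\<S>"
    using substructure_cutE[OF assms] by blast
  have sep': "separates n B A" "separator n B A \<subseteq> \<Union>\<S>"
    using separates_sym sep separator_commute by auto
  have sz: "card (separator n A B) \<le> 2 * card \<S>"
    using card_Union_cliques[OF \<S>(1,3) sep(2)] .
  consider "card A = 1" | "card B = 1" | "card A \<ge> 2" "card B \<ge> 2"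
    using separates_card(1,2)[OF sep(1)] by linarith
  then show ?thesis
  proof cases
    case 1
    then show ?thesis using singleton_side_card[OF \<S>(1,3) sep] \<S>(2) by linarith
  next
    case 2
    then show ?thesis using singleton_side_card[OF \<S>(1,3) sep'] \<S>(2) by linarith
  next
    case 3
    then show ?thesis using separator_ge_2[OF sep(1)] sz \<S>(2) by linarith
  qed
qed

lemma substructure_cut_card_ge_n:
  assumes "substructure_cut (twisted_hypercube n) (path_graph 2) \<F>" "kappa (n - 1) \<ge> 2"
  shows "n \<le> card \<F>"
proof -
  obtain \<S> A B where \<S>: "finite \<S>" "card \<S> \<le> card \<F>" "\<And>S. S \<in> \<S> \<Longrightarrow> clique S"
    and sep: "separates n A B" "separator n A B \<subseteq> \<Union>\<S>"
    using substructure_cutE[OF assms(1)] by blast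
  have sep': "separates n B A" "separator n B A \<subseteq> \<Union>\<S>"
    using separates_sym sep separator_commute by auto
  have sz: "card (separator n A B) \<le> 2 * card \<S>"
    using card_Union_cliques[OF \<S>(1,3) sep(2)] .
  \<comment> \<open>\<open>kappa (n - 1) \<ge> 2\<close> needs \<open>n - 1 \<ge> 4\<close>, which
    is the range of \<open>separator_ge_3\<close>.\<close>
  have n: "n \<ge> 5"
    using kappa_half[of "n - 1"] assms(2) by simp
  consider "card A = 1" | "card B = 1" | "card A = 2" | "card B = 2" | "card A \<ge> 3" "card B \<ge> 3"
    using separates_card(1,2)[OF sep(1)] by linarith
  then show ?thesis
  proof cases
    case 1
    then show ?thesis using singleton_side_card[OF \<S>(1,3) sep] \<S>(2) by linarith
  next
    case 2
    then show ?thesis using singleton_side_card[OF \<S>(1,3) sep'] \<S>(2) by linarith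
  next
    case 3
    then show ?thesis using doubleton_side_card[OF \<S>(1,3) sep _ assms(2)] \<S>(2) by linarith
  next
    case 4
    then show ?thesis using doubleton_side_card[OF \<S>(1,3) sep' _ assms(2)] \<S>(2) by linarith
  next
    case 5
    \<comment> \<open>At least \<open>2 * n - 1\<close> vertices in cliques of size at most 2
      require \<open>n\<close> cliques.\<close>
    then show ?thesis using separator_ge_3[OF sep(1) _ _ n] sz \<S>(2) by linarith
  qed
qed

section \<open>Explicit structure cuts\<close>

definition edge_graph :: "bit list \<Rightarrow> bit list \<Rightarrow> bit list pair_pre_digraph" where
  "edge_graph x y = \<lparr> pverts = {x, y}, parcs = {(x, y), (y, x)} \<rparr>"

lemma undirected_subgraph_edge_graph:
  assumes "length x = n" "adj x y"
  shows "undirected_subgraph (edge_graph x y) (twisted_hypercube n)"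
proof -
  have "x \<noteq> y" using assms(2) by auto
  then have "pair_graph (edge_graph x y)"
    by unfold_locales (auto simp: edge_graph_def symmetric_def sym_def)
  moreover have "wf_digraph (with_proj (edge_graph x y))"
    by unfold_locales (auto simp: edge_graph_def)
  moreover have "wf_digraph (with_proj (twisted_hypercube n))"
    by unfold_locales (auto simp: pverts_twisted_hypercube parcs_twisted_hypercube adj_length)
  ultimately show ?thesis
    using assms adj_sym adj_length[OF assms(2)]
    by (auto simp: undirected_subgraph_def subgraph_def edge_graph_def pverts_twisted_hypercube
        parcs_twisted_hypercube)
qed

lemma digraph_iso_edge_graph:
  assumes "x \<noteq> y"
  shows "digraph_iso (with_proj (edge_graph x y)) (with_proj (path_graph 2))"
proof -
  define g :: "bit list \<Rightarrow> nat" where "g = (\<lambda>z. if z = x then 0 else 1)"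
  define f where "f = \<lparr> iso_verts = g, iso_arcs = map_prod g g, iso_head = snd, iso_tail = fst \<rparr>"
  have "wf_digraph (with_proj (edge_graph x y))"
    by unfold_locales (auto simp: edge_graph_def)
  then have "pre_digraph.digraph_isomorphism (with_proj (edge_graph x y)) f"
    using assms by (auto simp: pre_digraph.digraph_isomorphism_def f_def g_def edge_graph_def)
  moreover have "with_proj (path_graph 2) = app_iso f (with_proj (edge_graph x y))"
    using assms
    by (auto simp: with_proj_def app_iso_def f_def g_def edge_graph_def pverts_path_graph_2 parcs_path_graph_2)
  ultimately show ?thesis
    by (auto simp: digraph_iso_def)
qed

text \<open>The edges from \<open>y\<close> to \<open>g y\<close> surround \<open>A\<close>, and the
  size condition leaves a vertex for the other side. Different \<open>y\<close> may give the same
  edge.\<close>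

lemma structure_connectivity_le:
  assumes "\<And>y. y \<in> Y \<Longrightarrow> length y = n \<and> adj y (g y)" "finite Y"
    and A: "A \<subseteq> bitstrings n" "A \<noteq> {}" "A \<inter> (Y \<union> g ` Y) = {}"
    and nb: "\<And>x y. x \<in> A \<Longrightarrow> adj x y \<Longrightarrow> y \<in> A \<union> Y \<union> g ` Y"
    and size: "card A + 2 * card Y < 2 ^ n"
  shows "structure_connectivity (twisted_hypercube n) (path_graph 2) \<le> enat (card Y)"
proof -
  let ?F = "(\<lambda>y. edge_graph y (g y)) ` Y"
  let ?B = "bitstrings n - (A \<union> Y \<union> g ` Y)"
  have "finite A"
    using A(1) finite_bitstrings by (rule finite_subset)
  then have "card (A \<union> Y \<union> g ` Y) \<le> card A + card Y + card (g ` Y)"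
    by (meson card_Un_le add_le_mono1 le_trans)
  also have "\<dots> < card (bitstrings n)"
    using size card_image_le[OF assms(2), of g] by (simp add: card_bitstrings)
  finally have "?B \<noteq> {}"
    using assms(2) \<open>finite A\<close> by (metis Diff_eq_empty_iff card_mono finite_UnI finite_imageI not_le)
  then have "separates n A ?B"
    using A nb unfolding separates_def by blast
  moreover have "(\<Union>S\<in>?F. pverts S) = Y \<union> g ` Y"
    by (auto simp: edge_graph_def)
  then have "A \<union> ?B = bitstrings n - (\<Union>S\<in>?F. pverts S)"
    using A(1,3) by blast
  ultimately have "disconnected (delete_family (twisted_hypercube n) ?F)"
    unfolding disconnected_delete_family_iff by (intro exI conjI)
  moreover have "undirected_subgraph S (twisted_hypercube n) \<and> digraph_iso (with_proj S) (with_proj (path_graph 2))"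
    if S: "S \<in> ?F" for S
  proof -
    obtain y where y: "S = edge_graph y (g y)" "length y = n" "adj y (g y)"
      using assms(1) S by blast
    then have "y \<noteq> g y"
      by (metis adj_irrefl)
    then show ?thesis
      unfolding y(1) using undirected_subgraph_edge_graph[OF y(2,3)] digraph_iso_edge_graph by blast
  qed
  ultimately have "structure_cut (twisted_hypercube n) (path_graph 2) ?F"
    using assms(2) by (simp add: structure_cut_def)
  then have "structure_connectivity (twisted_hypercube n) (path_graph 2) \<le> enat (card ?F)"
    unfolding structure_connectivity_def by (intro INF_lower) simp
  also have "\<dots> \<le> enat (card Y)"
    using card_image_le[OF assms(2)] by simp
  finally show ?thesis .
qed

text \<open>Isolates a vertex: each of its neighbours has degree \<open>n \<ge> 2\<close>, hence a
  further neighbour to form an edge with.\<close>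

lemma structure_connectivity_le_n:
  assumes "n \<ge> 3"
  shows "structure_connectivity (twisted_hypercube n) (path_graph 2) \<le> enat n"
proof -
  define u :: "bit list" where "u = replicate n 0"
  have u: "length u = n" by (simp add: u_def)
  let ?Y = "{y. adj u y}"
  have "\<exists>z. adj y z \<and> z \<noteq> u" if "adj u y" for y
  proof (rule ccontr)
    assume "\<not> ?thesis"
    then have "{z. adj y z} \<subseteq> {u}" by blast
    then have "card {z. adj y z} \<le> 1"
      using card_mono[of "{u}"] by fastforce
    then show False
      using assms adj_length[OF that] u by (simp add: card_neighbours)
  qed
  then obtain g where g: "\<And>y. adj u y \<Longrightarrow> adj y (g y) \<and> g y \<noteq> u"
    by metis
  have "2 * n + 2 \<le> 2 ^ n"
    using assms by (induction n rule: dec_induct) auto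
  then have "structure_connectivity (twisted_hypercube n) (path_graph 2) \<le> enat (card ?Y)"
    using g u adj_length by (intro structure_connectivity_le[where A = "{u}" and g = g])
      (auto simp: card_neighbours)
  then show ?thesis
    by (simp add: card_neighbours u)
qed

text \<open>Isolates an edge from \<open>u\<close> to \<open>g u\<close>: the flip \<open>g\<close>
  carries the other neighbours of \<open>u\<close> to those of \<open>g u\<close>, and each
  \<open>y\<close> is adjacent to \<open>g y\<close>, so one edge covers both.\<close>

lemma structure_connectivity_le_n_minus_1:
  assumes "n \<ge> 3" "kappa (n - 1) \<le> 1"
  shows "structure_connectivity (twisted_hypercube n) (path_graph 2) \<le> enat (n - 1)"
proof -
  define u :: "bit list" where "u = replicate n 0"
  have u: "length u = n" by (simp add: u_def)
  define g where "g = flip (n - 2)"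
  define v where "v = g u"
  let ?Y = "{y. adj u y} - {v}"
  have v: "length v = n" by (simp add: v_def g_def u)
  have gg: "g (g y) = y" if "length y = n" for y
    using that assms(1) by (simp add: g_def)
  have adj_g: "adj y (g y)" if "length y = n" for y
    using adj_flip[of 2 y] that assms(1) by (simp add: g_def)
  have g_adj: "adj (g x) (g y)" if "length x = n" "adj x y" for x y
    using adj_flip_second_last[of x y] that adj_length[OF that(2)] kappa_le_1_downward[OF assms(2)]
    by (simp add: g_def)
  have uv: "adj u v"
    using adj_g u v_def by simp
  have card: "card ?Y = n - 1"
    using uv by (simp add: card_neighbours u)
  have len: "length y = n" if "adj u y \<or> adj v y" for y
    using that adj_length u v by metis
  have "2 * n + 2 \<le> 2 ^ n"
    using assms(1) by (induction n rule: dec_induct) auto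
  moreover have "card {u, v} \<le> 2"
    by (simp add: card_insert_le_m1)
  ultimately have size: "card {u, v} + 2 * card ?Y < 2 ^ n"
    using card assms(1) by linarith
  have disj: "{u, v} \<inter> (?Y \<union> g ` ?Y) = {}"
  proof -
    have "g y \<noteq> u" "g y \<noteq> v" if "y \<in> ?Y" for y
    proof -
      have y: "length y = n" "adj u y" "y \<noteq> v"
        using that len by auto
      show "g y \<noteq> u" using gg[OF y(1)] y(3) v_def by metis
      show "g y \<noteq> v" using gg[OF y(1)] gg[OF u] y(2) v_def adj_irrefl by metis
    qed
    then show ?thesis by auto
  qed
  have nb: "y \<in> {u, v} \<union> ?Y \<union> g ` ?Y" if "x \<in> {u, v}" "adj x y" for x y
  proof (cases "x = u")
    case True
    then show ?thesis using that by blast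
  next
    case False
    then have "adj v y" using that by simp
    then have y: "length y = n" "adj u (g y)"
      using len g_adj[OF v] gg[OF u] v_def by metis+
    show ?thesis
    proof (cases "g y = v")
      case True
      then have "y = u" using gg[OF y(1)] gg[OF u] v_def by metis
      then show ?thesis by simp
    next
      case False
      then have "g y \<in> ?Y" using y by simp
      then show ?thesis using gg[OF y(1)] by (metis UnI2 imageI)
    qed
  qed
  have "structure_connectivity (twisted_hypercube n) (path_graph 2) \<le> enat (card ?Y)"
  proof (rule structure_connectivity_le[OF _ _ _ _ disj nb size])
    show "length y = n \<and> adj y (g y)" if "y \<in> ?Y" for y
      using that len adj_g by blast
  qed (use u v in auto)
  then show ?thesis by (simp only: card)
qed

lemma structure_cut_imp_substructure_cut:
  assumes "structure_cut G (path_graph 2) \<F>"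
  shows "substructure_cut G (path_graph 2) \<F>"
proof -
  have "wf_digraph (with_proj (path_graph 2))"
    by unfold_locales (auto simp: pverts_path_graph_2 parcs_path_graph_2)
  then have "undirected_subgraph (path_graph 2) (path_graph 2)"
    using pair_graph_path_graph_2 by (auto simp: undirected_subgraph_def subgraph_def)
  moreover have "Digraph_Component.connected (with_proj (path_graph 2))"
  proof -
    have "(a, b) \<in> rtrancl_on {0, 1} (symcl {(0, 1), (1, 0)})" if "a \<in> {0, 1}" "b \<in> {0, 1 :: nat}" for a b
      using that by (cases "a = b") (auto simp: symcl_def intro: rtrancl_on_into_rtrancl_on[OF rtrancl_on_refl])
    then show ?thesis
      unfolding connected_conv with_proj_simps pverts_path_graph_2 parcs_path_graph_2 by blast
  qed
  ultimately show ?thesis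
    using assms unfolding structure_cut_def substructure_cut_def by blast
qed

text \<open>Every structure cut is a substructure cut, so these two bounds enclose both
  numbers.\<close>

lemma connectivity_eqI:
  assumes "structure_connectivity G (path_graph 2) \<le> enat k"
    and "\<And>\<F>. substructure_cut G (path_graph 2) \<F> \<Longrightarrow> k \<le> card \<F>"
  shows "structure_connectivity G (path_graph 2) = enat k \<and> substructure_connectivity G (path_graph 2) = enat k"
proof -
  have "substructure_connectivity G (path_graph 2) \<le> structure_connectivity G (path_graph 2)"
    unfolding structure_connectivity_def substructure_connectivity_def
    using structure_cut_imp_substructure_cut by (intro INF_superset_mono) auto
  moreover have "enat k \<le> substructure_connectivity G (path_graph 2)"
    unfolding substructure_connectivity_def using assms(2) by (intro INF_greatest) simp
  ultimately show ?thesis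
    using assms(1) by (metis order.antisym order.trans)
qed

theorem theorem4p4:
  fixes n :: nat
  assumes "n \<ge> 2"
  shows "(kappa (n - 1) = 1 \<longrightarrow>
            structure_connectivity (twisted_hypercube n) (path_graph 2) = enat (n - 1) \<and>
            substructure_connectivity (twisted_hypercube n) (path_graph 2) = enat (n - 1)) \<and>
         (kappa (n - 1) \<ge> 2 \<longrightarrow>
            structure_connectivity (twisted_hypercube n) (path_graph 2) = enat n \<and>
            substructure_connectivity (twisted_hypercube n) (path_graph 2) = enat n)"
proof (intro conjI[of "_ \<longrightarrow> _"] impI)
  assume k: "kappa (n - 1) = 1"
  then have "n \<ge> 3"
    using kappa_half[of "n - 1"] by simp
  then show "structure_connectivity (twisted_hypercube n) (path_graph 2) = enat (n - 1) \<and>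
      substructure_connectivity (twisted_hypercube n) (path_graph 2) = enat (n - 1)"
    using k substructure_cut_card_ge_n_minus_1
    by (intro connectivity_eqI structure_connectivity_le_n_minus_1) (auto simp: le_diff_conv)
next
  assume k: "kappa (n - 1) \<ge> 2"
  then have "n \<ge> 3"
    using kappa_half[of "n - 1"] by simp
  then show "structure_connectivity (twisted_hypercube n) (path_graph 2) = enat n \<and>
      substructure_connectivity (twisted_hypercube n) (path_graph 2) = enat n"
    using substructure_cut_card_ge_n[OF _ k]
    by (intro connectivity_eqI structure_connectivity_le_n)
qed

end
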